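(* Let $Z \sim N(0,1)$. Let $f : \mathbb{R} \to \mathbb{R}$ be piecewise absolutely continuous (p-absolutely continuous), with discontinuity set $\mathcal{D}(f) = \{\delta_1, \ldots, \delta_m\}$. Let $f'$ be its (almost everywhere defined) derivative, and assume that $\mathbb{E}|f'(Z)| < \infty$. Then $$\mathbb{E}[Z f(Z)] = \mathbb{E}[f'(Z)] + \sum_{k=1}^m \phi(\delta_k) \big[ f(\delta_k)_+ - f(\delta_k)_- \big],$$ where $\phi$ is the standard normal density.
   Context: A function $f : \mathbb{R} \to \mathbb{R}$ is piecewise absolutely continuous, or p-absolutely continuous, if there exist points $\delta_1 < \delta_2 < \cdots < \delta_m$ such that $f$ is absolutely continuous on each one of the open intervals $(-\infty, \delta_1), (\delta_1, \delta_2), \ldots, (\delta_m, \infty)$. For such $f$, one writes $\mathcal{D}(f) = \{\delta_1, \ldots, \delta_m\}$ for its discontinuity set. Such a function has a derivative almost everywhere, denoted $f'$. One-sided limits are denoted $$f(x)_+ = \lim_{t \downarrow x} f(t), \qquad f(x)_- = \lim_{t \uparrow x} f(t).$$ *)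

theory Defs
  imports "HOL-Probability.Probability"
begin

definition absolutely_continuous_on :: "real set \<Rightarrow> (real \<Rightarrow> real) \<Rightarrow> bool" where
  "absolutely_continuous_on S f \<longleftrightarrow>
     (\<forall>\<epsilon>>0. \<exists>\<eta>>0. \<forall>(n::nat) (a :: nat \<Rightarrow> real) (b :: nat \<Rightarrow> real).
        (\<forall>i<n. a i \<le> b i \<and> {a i..b i} \<subseteq> S) \<longrightarrow>
        disjoint_family_on (\<lambda>i. {a i<..<b i}) {..<n} \<longrightarrow>
        (\<Sum>i<n. b i - a i) < \<eta> \<longrightarrow>
        (\<Sum>i<n. \<bar>f (b i) - f (a i)\<bar>) < \<epsilon>)"

(* On an open interval absolute continuity is understood on compact subintervals, as is usual
   for unbounded intervals: with a single modulus on the whole line even x^2 would be excluded.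
   This class contains every function satisfying the epsilon-eta condition on all of I. *)
definition absolutely_continuous_on_interval :: "real set \<Rightarrow> (real \<Rightarrow> real) \<Rightarrow> bool" where
  "absolutely_continuous_on_interval I f \<longleftrightarrow>
     (\<forall>a b. {a..b} \<subseteq> I \<longrightarrow> absolutely_continuous_on {a..b} f)"

(* The points are \<delta> 1, ..., \<delta> m, flanked by -\<infinity> (index 0) and \<infinity> (index m + 1). *)
definition breakpoint :: "nat \<Rightarrow> (nat \<Rightarrow> real) \<Rightarrow> nat \<Rightarrow> ereal" where
  "breakpoint m \<delta> k = (if k = 0 then - \<infinity> else if k \<le> m then ereal (\<delta> k) else \<infinity>)"

(* m = 0 is allowed and means absolute continuity on the whole line.  The function f need not
   actually jump at every \<delta> k, and its value at \<delta> k is unconstrained. *)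
definition p_absolutely_continuous :: "nat \<Rightarrow> (nat \<Rightarrow> real) \<Rightarrow> (real \<Rightarrow> real) \<Rightarrow> bool" where
  "p_absolutely_continuous m \<delta> f \<longleftrightarrow>
     strict_mono_on {1..m} \<delta> \<and>
     (\<forall>k\<le>m. absolutely_continuous_on_interval
              (einterval (breakpoint m \<delta> k) (breakpoint m \<delta> (Suc k))) f)"

definition ae_derivative :: "(real \<Rightarrow> real) \<Rightarrow> (real \<Rightarrow> real) \<Rightarrow> bool" where
  "ae_derivative f f' \<longleftrightarrow> (AE x in lborel. (f has_real_derivative f' x) (at x))"

(* Lim is a definite description, so these are meaningful only where the limits exist. *)
definition right_limit :: "(real \<Rightarrow> real) \<Rightarrow> real \<Rightarrow> real" where
  "right_limit f x = Lim (at_right x) f"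

definition left_limit :: "(real \<Rightarrow> real) \<Rightarrow> real \<Rightarrow> real" where
  "left_limit f x = Lim (at_left x) f"

end

theory Submission
  imports Defs
begin

text \<open>
  Up to a constant, a piecewise absolutely continuous function is the distribution function of a
  signed measure: an absolutely continuous part with density \<open>f'\<close>, plus an atom at each
  \<open>\<delta> k\<close> whose mass \<open>J k\<close> is the jump of \<open>f\<close> there. Off the breakpoints, with \<open>g = f'\<close> almost everywhere,
  \<open>f x = c + (\<integral>t. g t * (1[t < x] - 1[t < 0])) + (\<Sum>k. J k * 1[\<delta> k < x])\<close>.
  The identity is linear in \<open>f\<close>, so it need only be checked on constants and on the functions \<open>x \<mapsto> 1[t < x]\<close>, for which
  it is the Gaussian tail integral \<open>E (Z * 1[t < Z]) = \<phi> t\<close>, valid for every real \<open>t\<close>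
  (\<open>std_normal_first_moment_tail\<close>). An atom therefore contributes \<open>J k * \<phi> (\<delta> k)\<close>, a
  constant contributes nothing because \<open>E Z = 0\<close>, and the density contributes
  \<open>\<integral>t. g t * \<phi> t = E (f' Z)\<close> by Fubini's theorem (\<open>stein_primitive\<close>). The kernel
  \<open>1[t < x] - 1[t < 0]\<close> never has the sign opposite to \<open>x\<close>, so the assumption \<open>E \<bar>f' Z\<bar> < \<infinity>\<close> is exactly the
  absolute integrability that Fubini requires, and integrability of \<open>Z * f Z\<close> comes out for free.

  The representation of \<open>f\<close> rests on the fundamental theorem of calculus for absolutely continuous
  functions (\<open>fundamental_theorem_of_calculus_absolutely_continuous\<close>), proved with
  Henstock--Kurzweil gauges. It makes \<open>f\<close> minus the primitive of \<open>g\<close> constant on each piece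
  (\<open>p_absolutely_continuous_eq_primitive\<close>). As \<open>\<phi>\<close> is bounded below on bounded sets, \<open>g\<close> is locally
  integrable and its primitive is continuous, so the one-sided limits exist and their differences
  are the differences of consecutive constants.

  Finally, \<open>f'\<close> is prescribed only almost everywhere and need not be Borel measurable; the limit of
  difference quotients (\<open>forward_derivative\<close>) supplies a Borel version \<open>g\<close>.
\<close>

section \<open>Absolutely continuous functions on a compact interval\<close>

text \<open>Tagged divisions are finite sets rather than sequences, so the condition on
  sequences of intervals is needed for families with an arbitrary finite index set.\<close>
lemma absolutely_continuous_on_finite_family:
  fixes f :: "real \<Rightarrow> real"
  assumes "absolutely_continuous_on S f" and "\<epsilon> > 0"
  obtains \<eta> where "\<eta> > 0"
    and "\<And>(I :: 'i set) l u. finite I \<Longrightarrow> (\<And>i. i \<in> I \<Longrightarrow> l i \<le> u i \<and> {l i..u i} \<subseteq> S) \<Longrightarrow>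
           disjoint_family_on (\<lambda>i. {l i<..<u i}) I \<Longrightarrow> (\<Sum>i\<in>I. u i - l i) < \<eta> \<Longrightarrow>
           (\<Sum>i\<in>I. \<bar>f (u i) - f (l i)\<bar>) < \<epsilon>"
proof -
  obtain \<eta> where "\<eta> > 0" and \<eta>: "\<And>(n::nat) (a :: nat \<Rightarrow> real) (b :: nat \<Rightarrow> real).
        (\<forall>i<n. a i \<le> b i \<and> {a i..b i} \<subseteq> S) \<Longrightarrow>
        disjoint_family_on (\<lambda>i. {a i<..<b i}) {..<n} \<Longrightarrow>
        (\<Sum>i<n. b i - a i) < \<eta> \<Longrightarrow> (\<Sum>i<n. \<bar>f (b i) - f (a i)\<bar>) < \<epsilon>"
    using assms unfolding absolutely_continuous_on_def by meson
  show thesis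
  proof (rule that[OF \<open>\<eta> > 0\<close>])
    fix I :: "'i set" and l u :: "'i \<Rightarrow> real"
    assume I: "finite I" "\<And>i. i \<in> I \<Longrightarrow> l i \<le> u i \<and> {l i..u i} \<subseteq> S"
      "disjoint_family_on (\<lambda>i. {l i<..<u i}) I" "(\<Sum>i\<in>I. u i - l i) < \<eta>"
    obtain h where h: "bij_betw h {..<card I} I"
      using bij_betw_from_nat_into_finite[OF I(1)] by blast
    have mem: "h i \<in> I" if "i < card I" for i
      using h that by (auto simp: bij_betw_def)
    have "(\<Sum>i<card I. \<bar>f (u (h i)) - f (l (h i))\<bar>) < \<epsilon>"
    proof (rule \<eta>)
      show "\<forall>i<card I. l (h i) \<le> u (h i) \<and> {l (h i)..u (h i)} \<subseteq> S"
        using I(2) mem by blast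
      show "disjoint_family_on (\<lambda>i. {l (h i)<..<u (h i)}) {..<card I}"
        using I(3) h mem unfolding disjoint_family_on_def bij_betw_def inj_on_def
        by (metis lessThan_iff)
      show "(\<Sum>i<card I. u (h i) - l (h i)) < \<eta>"
        using I(4) sum.reindex_bij_betw[OF h, of "\<lambda>i. u i - l i"] by simp
    qed
    then show "(\<Sum>i\<in>I. \<bar>f (u i) - f (l i)\<bar>) < \<epsilon>"
      using sum.reindex_bij_betw[OF h, of "\<lambda>i. \<bar>f (u i) - f (l i)\<bar>"] by simp
  qed
qed

lemma absolutely_continuous_on_imp_continuous_on:
  assumes "absolutely_continuous_on {a..b} f"
  shows "continuous_on {a..b} f"
  unfolding continuous_on_iff
proof (intro ballI allI impI)
  fix x e :: real
  assume x: "x \<in> {a..b}" and "0 < e"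
  then obtain \<eta> where "\<eta> > 0"
    and \<eta>: "\<And>(I :: unit set) l u. finite I \<Longrightarrow> (\<And>i. i \<in> I \<Longrightarrow> l i \<le> u i \<and> {l i..u i} \<subseteq> {a..b}) \<Longrightarrow>
           disjoint_family_on (\<lambda>i. {l i<..<u i}) I \<Longrightarrow> (\<Sum>i\<in>I. u i - l i) < \<eta> \<Longrightarrow>
           (\<Sum>i\<in>I. \<bar>f (u i) - f (l i)\<bar>) < e"
    using absolutely_continuous_on_finite_family[OF assms, where 'i = unit] by blast
  show "\<exists>d>0. \<forall>x'\<in>{a..b}. dist x' x < d \<longrightarrow> dist (f x') (f x) < e"
  proof (intro exI[of _ \<eta>] conjI ballI impI)
    fix y assume y: "y \<in> {a..b}" "dist y x < \<eta>"
    have "\<bar>f (max x y) - f (min x y)\<bar> < e"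
      using \<eta>[of UNIV "\<lambda>_. min x y" "\<lambda>_. max x y"] x y
      by (auto simp: disjoint_family_on_def UNIV_unit dist_real_def)
    then show "dist (f y) (f x) < e"
      by (auto simp: dist_real_def max_def min_def split: if_splits)
  qed fact
qed

text \<open>
  Redefine the derivative as \<open>0\<close> on the null set \<open>N\<close> where it may fail to exist, and cover \<open>N\<close> by an
  open set \<open>U\<close> of measure less than \<open>\<eta>\<close>. Choose the gauge so that a division interval with tag in \<open>N\<close>
  lies inside \<open>U\<close>, while one with tag outside \<open>N\<close> is short enough for the linear approximation to be
  accurate. The intervals of the second kind give a small error as in the classical theorem; those
  of the first kind have total length below \<open>\<eta>\<close>, so by absolute continuity the increments of \<open>f\<close> over
  them, the whole error there, are small in sum. Integrability of the derivative in the gauge sense is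
  thus part of the conclusion.
\<close>
lemma fundamental_theorem_of_calculus_absolutely_continuous:
  fixes f f' :: "real \<Rightarrow> real"
  assumes "a \<le> b" and ac: "absolutely_continuous_on {a..b} f"
    and deriv: "AE x\<in>{a..b} in lborel. (f has_real_derivative f' x) (at x within {a..b})"
  shows "(f' has_integral f b - f a) {a..b}"
proof -
  obtain N where N: "N \<in> null_sets lborel"
    and derivN: "\<And>x. x \<in> {a..b} \<Longrightarrow> x \<notin> N \<Longrightarrow> (f has_real_derivative f' x) (at x within {a..b})"
  proof (rule AE_E3[OF deriv])
    fix N assume "N \<in> null_sets lborel"
      "\<And>x. x \<in> space lborel - N \<Longrightarrow> x \<in> {a..b} \<longrightarrow> (f has_real_derivative f' x) (at x within {a..b})"
    then show thesis by (intro that) auto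
  qed
  define g where "g x = (if x \<in> N then 0 else f' x)" for x
  have "(g has_integral f b - f a) (cbox a b)"
    unfolding has_integral
  proof (intro allI impI)
    fix e :: real assume "e > 0"
    \<comment> \<open>The summand \<open>1\<close> avoids division by zero when \<open>a = b\<close>.\<close>
    define e1 where "e1 = e / (2 * (b - a + 1))"
    have e1: "e1 > 0" "e1 * (b - a) \<le> e / 2"
      using \<open>e > 0\<close> \<open>a \<le> b\<close> by (auto simp: e1_def field_simps)
    obtain \<eta> where "\<eta> > 0" and \<eta>: "\<And>(I :: (real \<times> real set) set) l u. finite I \<Longrightarrow>
           (\<And>i. i \<in> I \<Longrightarrow> l i \<le> u i \<and> {l i..u i} \<subseteq> {a..b}) \<Longrightarrow>
           disjoint_family_on (\<lambda>i. {l i<..<u i}) I \<Longrightarrow> (\<Sum>i\<in>I. u i - l i) < \<eta> \<Longrightarrow>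
           (\<Sum>i\<in>I. \<bar>f (u i) - f (l i)\<bar>) < e / 2"
      using absolutely_continuous_on_finite_family[OF ac, of "e / 2", where 'i = "real \<times> real set"]
        half_gt_zero[OF \<open>e > 0\<close>] by blast
    obtain U where U: "open U" "N \<subseteq> U" "emeasure lborel (U - N) < ennreal \<eta>"
      using outer_regular_lborel[of N \<eta>] null_setsD2[OF N] \<open>\<eta> > 0\<close> by (metis sets_lborel)
    have emU: "emeasure lborel U < ennreal \<eta>"
      using U(1,3) N emeasure_Diff_null_set[of N lborel U] by simp
    have "\<exists>d. 0 < d \<and> (if x \<in> N then ball x d \<subseteq> U else x \<in> {a..b} \<longrightarrow>
        (\<forall>y\<in>{a..b}. \<bar>y - x\<bar> < d \<longrightarrow> \<bar>f y - f x - (y - x) * f' x\<bar> \<le> e1 * \<bar>y - x\<bar>))" for x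
    proof (cases "x \<in> N")
      case True
      then show ?thesis using U by (auto simp: open_contains_ball)
    next
      case False
      then show ?thesis
        using derivN[of x] e1(1) zero_less_one
        unfolding has_field_derivative_def has_derivative_within_alt
        by (cases "x \<in> {a..b}") (simp_all add: mult.commute, blast)
    qed
    then obtain d where d: "\<And>x. 0 < d x" "\<And>x. x \<in> N \<Longrightarrow> ball x (d x) \<subseteq> U"
      "\<And>x y. x \<notin> N \<Longrightarrow> x \<in> {a..b} \<Longrightarrow> y \<in> {a..b} \<Longrightarrow> \<bar>y - x\<bar> < d x \<Longrightarrow>
          \<bar>f y - f x - (y - x) * f' x\<bar> \<le> e1 * \<bar>y - x\<bar>"
      by metis
    show "\<exists>\<gamma>. gauge \<gamma> \<and> (\<forall>\<D>. \<D> tagged_division_of cbox a b \<and> \<gamma> fine \<D> \<longrightarrow>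
             norm ((\<Sum>(x, K)\<in>\<D>. measure lborel K *\<^sub>R g x) - (f b - f a)) < e)"
    proof (intro exI conjI allI impI)
      show "gauge (\<lambda>x. ball x (d x))"
        using d(1) gauge_ball_dependent by blast
      fix p assume "p tagged_division_of cbox a b \<and> (\<lambda>x. ball x (d x)) fine p"
      then have p: "p tagged_division_of cbox a b" and fine: "(\<lambda>x. ball x (d x)) fine p" by auto
      have fin: "finite p" using p by blast
      define l where "l = (\<lambda>i::real \<times> real set. Inf (snd i))"
      define u where "u = (\<lambda>i::real \<times> real set. Sup (snd i))"
      have piece: "snd i = {l i..u i} \<and> l i \<le> fst i \<and> fst i \<le> u i \<and> a \<le> l i \<and> u i \<le> b \<and>
          {l i..u i} \<subseteq> ball (fst i) (d (fst i))" if "i \<in> p" for i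
      proof -
        obtain x K where i: "i = (x, K)" by fastforce
        have xK: "(x, K) \<in> p" using that i by simp
        obtain v w where K: "K = cbox v w" using p xK by blast
        have "x \<in> K" "K \<subseteq> {a..b}" using p xK by (auto dest: tagged_division_ofD)
        moreover have "K \<subseteq> ball x (d x)" using fine xK by (auto simp: fine_def)
        ultimately show ?thesis
          by (auto simp: i l_def u_def K)
      qed
      define r where "r i = measure lborel (snd i) * g (fst i) - (f (u i) - f (l i))" for i
      have fba: "f b - f a = (\<Sum>i\<in>p. f (u i) - f (l i))" and ba: "b - a = (\<Sum>i\<in>p. u i - l i)"
        using additive_tagged_division_1[OF \<open>a \<le> b\<close>, of p f]
          additive_tagged_division_1[OF \<open>a \<le> b\<close>, of p "\<lambda>x. x"] p
        by (auto simp: l_def u_def split_def)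
      have good: "(\<Sum>i\<in>{i\<in>p. fst i \<notin> N}. \<bar>r i\<bar>) \<le> e / 2"
      proof -
        have "\<bar>r i\<bar> \<le> e1 * (u i - l i)" if "i \<in> p" "fst i \<notin> N" for i
        proof -
          note P = piece[OF that(1)]
          define x where "x = fst i"
          have le: "l i \<le> x" "x \<le> u i" using P by (auto simp: x_def)
          have "l i \<in> ball x (d x)" "u i \<in> ball x (d x)"
            using P unfolding x_def by (meson atLeastAtMost_iff order_refl order_trans subsetD)+
          then have near: "\<bar>l i - x\<bar> < d x" "\<bar>u i - x\<bar> < d x"
            by (simp_all add: dist_real_def abs_minus_commute)
          have "\<bar>f (l i) - f x - (l i - x) * f' x\<bar> \<le> e1 * \<bar>l i - x\<bar>"
            by (rule d(3)) (use P that near in \<open>auto simp: x_def\<close>)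
          moreover have "\<bar>f (u i) - f x - (u i - x) * f' x\<bar> \<le> e1 * \<bar>u i - x\<bar>"
            by (rule d(3)) (use P that near in \<open>auto simp: x_def\<close>)
          moreover have "r i = (f (l i) - f x - (l i - x) * f' x) - (f (u i) - f x - (u i - x) * f' x)"
            using P that by (simp add: r_def g_def x_def algebra_simps)
          moreover have "e1 * \<bar>l i - x\<bar> + e1 * \<bar>u i - x\<bar> = e1 * (u i - l i)"
            using le by (simp add: algebra_simps)
          ultimately show ?thesis by linarith
        qed
        then have "(\<Sum>i\<in>{i\<in>p. fst i \<notin> N}. \<bar>r i\<bar>) \<le> (\<Sum>i\<in>{i\<in>p. fst i \<notin> N}. e1 * (u i - l i))"
          by (intro sum_mono) auto
        also have "\<dots> \<le> (\<Sum>i\<in>p. e1 * (u i - l i))"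
          using piece e1 by (intro sum_mono2[OF fin]) (force intro!: mult_nonneg_nonneg)+
        also have "\<dots> = e1 * (b - a)"
          by (simp add: ba sum_distrib_left)
        finally show ?thesis using e1(2) by linarith
      qed
      have bad: "(\<Sum>i\<in>{i\<in>p. fst i \<in> N}. \<bar>r i\<bar>) < e / 2"
      proof -
        let ?B = "{i\<in>p. fst i \<in> N}"
        have disj: "disjoint_family_on (\<lambda>i. {l i<..<u i}) ?B"
          unfolding disjoint_family_on_def
        proof (intro ballI impI)
          fix i j assume ij: "i \<in> ?B" "j \<in> ?B" "i \<noteq> j"
          then have "interior (snd i) \<inter> interior (snd j) = {}"
            using tagged_division_ofD(5)[OF p, of "fst i" "snd i" "fst j" "snd j"] by (auto simp: prod_eq_iff)
          then show "{l i<..<u i} \<inter> {l j<..<u j} = {}"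
            using piece[of i] piece[of j] ij by (metis (lifting) interior_atLeastAtMost_real mem_Collect_eq)
        qed
        have "ennreal (\<Sum>i\<in>?B. u i - l i) = (\<Sum>i\<in>?B. ennreal (u i - l i))"
          using piece by (intro sum_ennreal[symmetric]) force
        also have "\<dots> = (\<Sum>i\<in>?B. emeasure lborel {l i<..<u i})"
          using piece by (intro sum.cong) force+
        also have "\<dots> = emeasure lborel (\<Union>i\<in>?B. {l i<..<u i})"
          using disj fin by (intro sum_emeasure) auto
        also have "\<dots> \<le> emeasure lborel U"
          using piece d(2) U(1) by (intro emeasure_mono) (fastforce simp: subset_iff)+
        also note emU
        finally have "(\<Sum>i\<in>?B. u i - l i) < \<eta>"
          by (meson ennreal_leI linorder_not_le)
        then have "(\<Sum>i\<in>?B. \<bar>f (u i) - f (l i)\<bar>) < e / 2"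
          using piece fin disj by (intro \<eta>) force+
        then show ?thesis by (simp add: r_def g_def abs_minus_commute)
      qed
      have "(\<Sum>(x, K)\<in>p. measure lborel K *\<^sub>R g x) - (f b - f a) = (\<Sum>i\<in>p. r i)"
        by (simp add: fba r_def split_def sum_subtractf)
      then have "norm ((\<Sum>(x, K)\<in>p. measure lborel K *\<^sub>R g x) - (f b - f a)) \<le> (\<Sum>i\<in>p. \<bar>r i\<bar>)"
        by (simp add: sum_abs)
      also have "\<dots> = (\<Sum>i\<in>{i\<in>p. fst i \<in> N}. \<bar>r i\<bar>) + (\<Sum>i\<in>{i\<in>p. fst i \<notin> N}. \<bar>r i\<bar>)"
        using fin by (subst sum.union_disjoint[symmetric]) (auto intro!: sum.cong)
      finally show "norm ((\<Sum>(x, K)\<in>p. measure lborel K *\<^sub>R g x) - (f b - f a)) < e"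
        using good bad by linarith
    qed
  qed
  then show ?thesis
    using N by (intro has_integral_spike[of N "{a..b}" f' g])
      (auto simp: g_def negligible_iff_null_sets intro: null_sets_completionI)
qed

section \<open>Gaussian first moments and Fubini's theorem\<close>

lemma has_real_derivative_std_normal_density:
  "((\<lambda>x. - std_normal_density x) has_real_derivative x * std_normal_density x) (at x within S)"
  unfolding std_normal_density_def by (auto intro!: derivative_eq_intros simp: field_simps)

lemma std_normal_density_at_top: "(std_normal_density \<longlongrightarrow> 0) at_top"
  unfolding std_normal_density_def by real_asymp

lemma integrable_std_normal_first_moment: "integrable lborel (\<lambda>x. std_normal_density x * x)"
  using integrable_std_normal_moment[of 1] by simp

text \<open>
  An antiderivative of \<open>x * \<phi> x\<close> is \<open>- \<phi> x\<close>, so the integral from \<open>t\<close> to \<open>y\<close> is \<open>\<phi> t - \<phi> y\<close>. Since the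
  integrand is known to be integrable, \<open>y\<close> may tend to infinity even when the integrand changes sign.
  This is Stein's identity for the indicator of a half line, which jumps by \<open>1\<close> at \<open>t\<close>.\<close>
lemma std_normal_first_moment_tail:
  "has_bochner_integral lborel (\<lambda>x. std_normal_density x * x * indicator {t<..} x) (std_normal_density t)"
proof -
  let ?h = "\<lambda>x. std_normal_density x * x * indicator {t<..} x"
  have int: "integrable lborel ?h"
    by (intro integrable_real_mult_indicator integrable_std_normal_first_moment) auto
  have "((\<lambda>y. \<integral>x. indicator {..y} x *\<^sub>R ?h x \<partial>lborel) \<longlongrightarrow> integral\<^sup>L lborel ?h) at_top"
    by (intro tendsto_integral_at_top int) auto
  moreover have "\<forall>\<^sub>F y in at_top. (\<integral>x. indicator {..y} x *\<^sub>R ?h x \<partial>lborel) = std_normal_density t - std_normal_density y"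
    using eventually_ge_at_top[of t]
  proof eventually_elim
    case (elim y)
    have "has_bochner_integral lborel (\<lambda>x. (x * std_normal_density x) * indicator {t..y} x) (- std_normal_density y - (- std_normal_density t))"
      using elim
      by (intro has_bochner_integral_FTC_Icc_real has_real_derivative_std_normal_density)
         (auto simp: std_normal_density_def intro!: continuous_intros)
    then have "(\<integral>x. (x * std_normal_density x) * indicator {t..y} x \<partial>lborel) = std_normal_density t - std_normal_density y"
      by (simp add: has_bochner_integral_integral_eq)
    moreover have "(\<integral>x. indicator {..y} x *\<^sub>R ?h x \<partial>lborel) = (\<integral>x. (x * std_normal_density x) * indicator {t..y} x \<partial>lborel)"
      using AE_lborel_singleton[of t]
      by (intro integral_cong_AE) (auto split: split_indicator)
    ultimately show ?case by simp
  qed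
  ultimately have "((\<lambda>y. std_normal_density t - std_normal_density y) \<longlongrightarrow> integral\<^sup>L lborel ?h) at_top"
    by (rule Lim_transform_eventually)
  moreover have "((\<lambda>y. std_normal_density t - std_normal_density y) \<longlongrightarrow> std_normal_density t - 0) at_top"
    by (intro tendsto_intros std_normal_density_at_top)
  ultimately have "integral\<^sup>L lborel ?h = std_normal_density t"
    using tendsto_unique[OF trivial_limit_at_top_linorder] by fastforce
  with int show ?thesis by (simp add: has_bochner_integral_iff)
qed

text \<open>
  Integrating \<open>g\<close> against this kernel in \<open>t\<close> gives the oriented integral of \<open>g\<close> from \<open>0\<close> to \<open>x\<close>: the kernel
  is \<open>1\<close> for \<open>0 \<le> t < x\<close>, is \<open>-1\<close> for \<open>x \<le> t < 0\<close>, and vanishes otherwise. In the form below its dependence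
  on \<open>x\<close> is a single half-line indicator.\<close>
definition primitive_kernel :: "real \<Rightarrow> real \<Rightarrow> real" where
  "primitive_kernel t x = indicator {t<..} x - indicator {..<0} t"

lemma primitive_kernel_measurable [measurable]:
  "(\<lambda>(t, x). primitive_kernel t x) \<in> borel_measurable (lborel \<Otimes>\<^sub>M lborel)"
proof -
  have "(\<lambda>(t, x). primitive_kernel t x) = (\<lambda>p. (if fst p < snd p then 1 else 0) - (if fst p < 0 then 1 else 0))"
    by (auto simp: primitive_kernel_def indicator_def)
  then show ?thesis by simp
qed

text \<open>The term \<open>1[t < 0]\<close> does not depend on \<open>x\<close> and is annihilated by the vanishing first moment.\<close>
lemma std_normal_first_moment_kernel:
  "has_bochner_integral lborel (\<lambda>x. std_normal_density x * x * primitive_kernel t x) (std_normal_density t)"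
proof -
  have "has_bochner_integral lborel (\<lambda>x. std_normal_density x * x * indicator {..<0} t) (0 * indicator {..<0} t)"
    using integral_std_normal_moment_odd[of 0] integrable_std_normal_first_moment
    by (intro has_bochner_integral_mult_left) (simp add: has_bochner_integral_iff)
  from has_bochner_integral_diff[OF std_normal_first_moment_tail[of t] this]
  show ?thesis by (simp add: primitive_kernel_def right_diff_distrib)
qed

text \<open>This positivity turns the Gaussian integral of the kernel into that of its absolute value,
  which is what makes Fubini's theorem applicable below.\<close>
lemma mult_primitive_kernel_nonneg: "0 \<le> x * primitive_kernel t x"
  by (auto simp: primitive_kernel_def indicator_def)

definition primitive :: "(real \<Rightarrow> real) \<Rightarrow> real \<Rightarrow> real" where
  "primitive g x = (\<integral>t. g t * primitive_kernel t x \<partial>lborel)"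

text \<open>
  Stein's identity for the absolutely continuous part. Exchanging the integrals over \<open>t\<close> and \<open>x\<close> leaves
  the kernel integral \<open>\<phi> t\<close>; with absolute values inside, the same computation gives
  \<open>\<integral>t. \<phi> t * \<bar>g t\<bar>\<close>, which is finite by assumption.\<close>
lemma stein_primitive:
  assumes g [measurable]: "g \<in> borel_measurable borel"
    and int: "integrable lborel (\<lambda>t. std_normal_density t * g t)"
  shows "has_bochner_integral lborel (\<lambda>x. std_normal_density x * (x * primitive g x))
           (\<integral>t. std_normal_density t * g t \<partial>lborel)"
proof -
  define K where "K = (\<lambda>(t, x). g t * (std_normal_density x * x * primitive_kernel t x))"
  have K_meas [measurable]: "K \<in> borel_measurable (lborel \<Otimes>\<^sub>M lborel)"
    unfolding K_def split_def using primitive_kernel_measurable[unfolded split_def] by simp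
  note ker = std_normal_first_moment_kernel[unfolded has_bochner_integral_iff]
  have K_int: "integrable (lborel \<Otimes>\<^sub>M lborel) K"
  proof (rule lborel_pair.Fubini_integrable[OF K_meas])
    have "norm (K (t, x)) = \<bar>g t\<bar> * (std_normal_density x * x * primitive_kernel t x)" for t x
      using mult_primitive_kernel_nonneg[of x t]
      by (simp add: K_def abs_mult mult.assoc) (metis abs_mult abs_of_nonneg)
    then have "(\<integral>x. norm (K (t, x)) \<partial>lborel) = \<bar>std_normal_density t * g t\<bar>" for t
      using ker[of t] by (simp add: abs_mult)
    then show "integrable lborel (\<lambda>t. \<integral>x. norm (K (t, x)) \<partial>lborel)"
      using int by simp
    show "AE t in lborel. integrable lborel (\<lambda>x. K (t, x))"
      using ker by (auto simp: K_def)
  qed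
  have inner: "(\<integral>t. K (t, x) \<partial>lborel) = std_normal_density x * (x * primitive g x)" for x
  proof -
    have "(\<integral>t. K (t, x) \<partial>lborel) = (\<integral>t. (std_normal_density x * x) * (g t * primitive_kernel t x) \<partial>lborel)"
      by (intro Bochner_Integration.integral_cong) (auto simp: K_def)
    then show ?thesis by (simp add: primitive_def)
  qed
  have "(\<integral>x. K (t, x) \<partial>lborel) = std_normal_density t * g t" for t
    using ker[of t] by (simp add: K_def)
  with lborel_pair.integrable_snd[of "\<lambda>t x. K (t, x)"] lborel_pair.Fubini_integral[of "\<lambda>t x. K (t, x)"] K_int
  show ?thesis by (simp add: inner has_bochner_integral_iff)
qed

lemma primitive_diff:
  assumes g [measurable]: "g \<in> borel_measurable borel"
    and int: "\<And>a b. set_integrable lborel {a..b} g" and "a \<le> b"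
  shows "primitive g b - primitive g a = (LBINT t:{a..b}. g t)"
proof -
  have ki: "integrable lborel (\<lambda>t. g t * primitive_kernel t x)" for x
  proof -
    have [measurable]: "(\<lambda>t. primitive_kernel t x) \<in> borel_measurable borel"
      using measurable_Pair2'[of x] primitive_kernel_measurable by simp
    \<comment> \<open>As a function of \<open>t\<close>, the kernel is supported between \<open>0\<close> and \<open>x\<close>.\<close>
    have "integrable lborel (\<lambda>t. (indicator {min 0 x..max 0 x} t *\<^sub>R g t) * primitive_kernel t x)"
      using int[of "min 0 x" "max 0 x"] unfolding set_integrable_def
      by (rule Bochner_Integration.integrable_bound)
         (auto, auto simp: primitive_kernel_def split: split_indicator)
    moreover have "(\<lambda>t. (indicator {min 0 x..max 0 x} t *\<^sub>R g t) * primitive_kernel t x) = (\<lambda>t. g t * primitive_kernel t x)"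
      by (auto simp: primitive_kernel_def indicator_def fun_eq_iff)
    ultimately show ?thesis by simp
  qed
  have "primitive g b - primitive g a = (\<integral>t. g t * primitive_kernel t b - g t * primitive_kernel t a \<partial>lborel)"
    unfolding primitive_def using ki by simp
  also have "\<dots> = (LBINT t:{a..<b}. g t)"
    unfolding set_lebesgue_integral_def using \<open>a \<le> b\<close>
    by (intro Bochner_Integration.integral_cong) (auto simp: primitive_kernel_def indicator_def)
  also have "\<dots> = (LBINT t:{a..b}. g t)"
    unfolding set_lebesgue_integral_def using AE_lborel_singleton[of b]
    by (intro integral_cong_AE) (auto split: split_indicator)
  finally show ?thesis .
qed

lemma isCont_primitive:
  assumes g [measurable]: "g \<in> borel_measurable borel"
    and int: "\<And>a b. set_integrable lborel {a..b} g"
  shows "isCont (primitive g) x"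
proof -
  have "continuous_on {x - 1..x + 1} (\<lambda>y. primitive g (x - 1) + integral {x - 1..y} g)"
    using set_borel_integral_eq_integral(1)[OF int]
    by (intro continuous_intros indefinite_integral_continuous_1)
  moreover have "primitive g (x - 1) + integral {x - 1..y} g = primitive g y" if "y \<in> {x - 1..x + 1}" for y
    using primitive_diff[OF g int, of "x - 1" y] set_borel_integral_eq_integral(2)[OF int] that by simp
  ultimately have "continuous_on {x - 1..x + 1} (primitive g)"
    by (rule continuous_on_eq)
  then show ?thesis
    by (rule continuous_on_interior) simp
qed

text \<open>The normal density is bounded below on \<open>{a..b}\<close> by its value at the larger of \<open>\<bar>a\<bar>\<close> and
  \<open>\<bar>b\<bar>\<close>, so the weight can be divided out locally.\<close>
lemma set_integrable_std_normal_weight: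
  assumes [measurable]: "g \<in> borel_measurable borel"
    and int: "integrable lborel (\<lambda>t. std_normal_density t * g t)"
  shows "set_integrable lborel {a..b} g"
proof -
  define r where "r = max \<bar>a\<bar> \<bar>b\<bar>"
  have le: "std_normal_density r \<le> std_normal_density t" if "t \<in> {a..b}" for t
  proof -
    have "t\<^sup>2 \<le> r\<^sup>2"
      using that by (intro abs_le_square_iff[THEN iffD1]) (auto simp: r_def)
    then show ?thesis by (auto simp: std_normal_density_def intro!: divide_right_mono)
  qed
  have pos: "std_normal_density r > 0" by (simp add: normal_density_pos)
  show ?thesis
    unfolding set_integrable_def
  proof (rule Bochner_Integration.integrable_bound)
    show "integrable lborel (\<lambda>t. (std_normal_density t * g t) / std_normal_density r)"
      using int by simp
    have "\<bar>g t\<bar> \<le> \<bar>std_normal_density t * g t / std_normal_density r\<bar>" if "t \<in> {a..b}" for t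
      using mult_right_mono[OF le[OF that], of "\<bar>g t\<bar>"] pos
      by (simp add: abs_mult pos_le_divide_eq mult.commute)
    then show "AE t in lborel. norm (indicator {a..b} t *\<^sub>R g t) \<le> norm ((std_normal_density t * g t) / std_normal_density r)"
      by (auto split: split_indicator)
  qed measurable
qed

section \<open>A Borel version of the derivative\<close>

text \<open>
  Writing the derivative as the limit of one sequence of difference quotients makes it
  Borel measurable whenever \<open>f\<close> is; where that limit does not exist the value is irrelevant.\<close>
definition forward_derivative :: "(real \<Rightarrow> real) \<Rightarrow> real \<Rightarrow> real" where
  "forward_derivative f x = lim (\<lambda>n. (f (x + inverse (real (Suc n))) - f x) / inverse (real (Suc n)))"

lemma forward_derivative_measurable [measurable]:
  assumes [measurable]: "f \<in> borel_measurable borel"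
  shows "forward_derivative f \<in> borel_measurable borel"
  unfolding forward_derivative_def by measurable

lemma forward_derivative_eq:
  assumes "(f has_real_derivative D) (at x)"
  shows "forward_derivative f x = D"
proof -
  have "((\<lambda>h. (f (x + h) - f x) / h) \<longlongrightarrow> D) (at 0)"
    using assms by (simp add: DERIV_def)
  moreover have "filterlim (\<lambda>n. inverse (real (Suc n))) (at 0) sequentially"
    using LIMSEQ_inverse_real_of_nat by (auto simp: filterlim_at simp del: of_nat_Suc)
  ultimately have "(\<lambda>n. (f (x + inverse (real (Suc n))) - f x) / inverse (real (Suc n))) \<longlonglongrightarrow> D"
    by (rule filterlim_compose)
  then show ?thesis by (simp add: forward_derivative_def limI)
qed

section \<open>Piecewise absolutely continuous functions\<close>

text \<open>Besides locating \<open>x\<close> in a piece, this identifies the breakpoints to the left of \<open>x\<close> as an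
  initial segment, over which the jumps will telescope.\<close>
lemma breakpoint_interval_containing:
  assumes mono: "strict_mono_on {1..m} \<delta>" and x: "x \<notin> \<delta> ` {1..m}"
  obtains j where "j \<le> m" and "{k \<in> {1..m}. \<delta> k < x} = {1..j}"
    and "x \<in> einterval (breakpoint m \<delta> j) (breakpoint m \<delta> (Suc j))"
proof -
  define A where "A = {k \<in> {1..m}. \<delta> k < x}"
  define j where "j = Max (insert 0 A)"
  have fin: "finite A" by (simp add: A_def)
  have j: "j = 0 \<or> j \<in> A" using Max_in[of "insert 0 A"] fin by (auto simp: j_def)
  have max: "k \<le> j" if "k \<in> A" for k using that fin by (simp add: j_def)
  have A: "A = {1..j}"
  proof (intro equalityI subsetI)
    fix k assume "k \<in> {1..j}"
    then have "j \<in> A" "k \<le> j" "1 \<le> k" using j by auto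
    then have "\<delta> k \<le> \<delta> j"
      using strict_mono_onD[OF mono, of k j] by (cases "k = j") (auto simp: A_def)
    with \<open>j \<in> A\<close> \<open>k \<le> j\<close> \<open>1 \<le> k\<close> show "k \<in> A" by (auto simp: A_def)
  qed (use max in \<open>auto simp: A_def\<close>)
  have jm: "j \<le> m" using j by (auto simp: A_def)
  have "Suc j \<notin> A" using max by fastforce
  moreover have "x \<noteq> \<delta> (Suc j)" if "Suc j \<le> m" using x that by force
  ultimately have "Suc j \<le> m \<Longrightarrow> x < \<delta> (Suc j)" by (force simp: A_def)
  then have "x \<in> einterval (breakpoint m \<delta> j) (breakpoint m \<delta> (Suc j))"
    using j by (auto simp: einterval_def breakpoint_def A_def)
  with that jm A show thesis by (simp add: A_def)
qed

lemma p_absolutely_continuous_isCont: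
  assumes pac: "p_absolutely_continuous m \<delta> f" and x: "x \<notin> \<delta> ` {1..m}"
  shows "isCont f x"
proof -
  obtain j where j: "j \<le> m" "x \<in> einterval (breakpoint m \<delta> j) (breakpoint m \<delta> (Suc j))"
    using breakpoint_interval_containing[OF _ x] pac unfolding p_absolutely_continuous_def by metis
  then obtain e where "e > 0" and e: "cball x e \<subseteq> einterval (breakpoint m \<delta> j) (breakpoint m \<delta> (Suc j))"
    using open_einterval open_contains_cball by metis
  then have "absolutely_continuous_on {x - e..x + e} f"
    using pac j(1) unfolding p_absolutely_continuous_def absolutely_continuous_on_interval_def
    by (simp add: cball_eq_atLeastAtMost)
  then have "continuous_on {x - e..x + e} f"
    by (rule absolutely_continuous_on_imp_continuous_on)
  then show ?thesis
    using \<open>e > 0\<close> by (intro continuous_on_interior[of "{x - e..x + e}" f]) auto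
qed

lemma p_absolutely_continuous_borel_measurable:
  assumes "p_absolutely_continuous m \<delta> f"
  shows "f \<in> borel_measurable borel"
proof (rule borel_measurable_continuous_countable_exceptions)
  show "countable (\<delta> ` {1..m})" by simp
  show "continuous_on (- \<delta> ` {1..m}) f"
    using p_absolutely_continuous_isCont[OF assms]
    by (auto intro: continuous_at_imp_continuous_on)
qed

text \<open>On each piece the increments of \<open>f\<close> and of the primitive agree, both being the integral of
  \<open>g\<close>.\<close>
lemma p_absolutely_continuous_eq_primitive:
  assumes pac: "p_absolutely_continuous m \<delta> f"
    and deriv: "AE x in lborel. (f has_real_derivative g x) (at x)"
    and g [measurable]: "g \<in> borel_measurable borel"
    and int: "\<And>a b. set_integrable lborel {a..b} g"
  obtains c where "\<And>k x. k \<le> m \<Longrightarrow> x \<in> einterval (breakpoint m \<delta> k) (breakpoint m \<delta> (Suc k)) \<Longrightarrow>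
    f x = c k + primitive g x"
proof -
  have le: "f y - primitive g y = f x - primitive g x"
    if "k \<le> m" "x \<in> einterval (breakpoint m \<delta> k) (breakpoint m \<delta> (Suc k))"
      "y \<in> einterval (breakpoint m \<delta> k) (breakpoint m \<delta> (Suc k))" "x \<le> y" for k x y
  proof -
    have "{x..y} \<subseteq> einterval (breakpoint m \<delta> k) (breakpoint m \<delta> (Suc k))"
      using that unfolding einterval_def
      by (auto intro: less_le_trans[of _ "ereal x"] le_less_trans[of _ "ereal y"])
    then have "absolutely_continuous_on {x..y} f"
      using pac that(1) by (simp add: p_absolutely_continuous_def absolutely_continuous_on_interval_def)
    moreover have "AE t\<in>{x..y} in lborel. (f has_real_derivative g t) (at t within {x..y})"
      using deriv by eventually_elim (auto intro: has_field_derivative_at_within)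
    ultimately have "(g has_integral f y - f x) {x..y}"
      by (intro fundamental_theorem_of_calculus_absolutely_continuous \<open>x \<le> y\<close>)
    then have "f y - f x = integral {x..y} g" by (simp add: integral_unique)
    also have "\<dots> = primitive g y - primitive g x"
      using primitive_diff[OF g int \<open>x \<le> y\<close>] set_borel_integral_eq_integral(2)[OF int] by simp
    finally show ?thesis by simp
  qed
  have "\<exists>c. \<forall>x\<in>einterval (breakpoint m \<delta> k) (breakpoint m \<delta> (Suc k)). f x - primitive g x = c" if "k \<le> m" for k
    using le[OF that] by (metis linear)
  then obtain c where "\<And>k. k \<le> m \<Longrightarrow> \<forall>x\<in>einterval (breakpoint m \<delta> k) (breakpoint m \<delta> (Suc k)). f x - primitive g x = c k"
    by metis
  then show thesis by (intro that[of c]) (simp add: diff_eq_eq)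
qed

lemma eventually_at_right_breakpoint:
  assumes "strict_mono_on {1..m} \<delta>" "k \<in> {1..m}"
  shows "\<forall>\<^sub>F x in at_right (\<delta> k). x \<in> einterval (breakpoint m \<delta> k) (breakpoint m \<delta> (Suc k))"
proof (cases "k = m")
  case True
  then show ?thesis
    using assms by (auto simp: einterval_def breakpoint_def eventually_at_right_less)
next
  case False
  then have "\<delta> k < \<delta> (Suc k)" using assms by (intro strict_mono_onD[OF assms(1)]) auto
  with eventually_at_right_real[OF this] show ?thesis
    using assms False by (auto simp: einterval_def breakpoint_def elim: eventually_mono)
qed

lemma eventually_at_left_breakpoint:
  assumes "strict_mono_on {1..m} \<delta>" "k \<in> {1..m}"
  shows "\<forall>\<^sub>F x in at_left (\<delta> k). x \<in> einterval (breakpoint m \<delta> (k - 1)) (breakpoint m \<delta> k)"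
proof (cases "k = 1")
  case True
  then show ?thesis
    using assms by (auto simp: einterval_def breakpoint_def eventually_at_filter)
next
  case False
  then have "\<delta> (k - 1) < \<delta> k" using assms by (intro strict_mono_onD[OF assms(1)]) auto
  with eventually_at_left_real[OF this] show ?thesis
    using assms False by (auto simp: einterval_def breakpoint_def elim: eventually_mono)
qed

section \<open>Stein's identity with jumps\<close>

text \<open>
  The theorem stated on the real line, for a Borel version \<open>g\<close> of the derivative. Let \<open>c k\<close> be the constant
  value of \<open>f\<close> minus the primitive on the \<open>k\<close>-th piece. By continuity of the primitive the jump at \<open>\<delta> k\<close> is
  \<open>c k - c (k - 1)\<close>; summing the jumps to the left of \<open>x\<close> telescopes and yields the representation of \<open>f\<close>
  as primitive plus constant plus step functions, whose terms are then integrated one by one.\<close>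
lemma stein_std_normal_density:
  fixes f g :: "real \<Rightarrow> real"
  assumes pac: "p_absolutely_continuous m \<delta> f"
    and deriv: "AE x in lborel. (f has_real_derivative g x) (at x)"
    and g [measurable]: "g \<in> borel_measurable borel"
    and int: "integrable lborel (\<lambda>t. std_normal_density t * g t)"
  shows "k \<in> {1..m} \<Longrightarrow> (f \<longlongrightarrow> right_limit f (\<delta> k)) (at_right (\<delta> k))" (is "_ \<Longrightarrow> ?R k")
    and "k \<in> {1..m} \<Longrightarrow> (f \<longlongrightarrow> left_limit f (\<delta> k)) (at_left (\<delta> k))" (is "_ \<Longrightarrow> ?L k")
    and "has_bochner_integral lborel (\<lambda>x. std_normal_density x * (x * f x))
      ((\<integral>t. std_normal_density t * g t \<partial>lborel) +
        (\<Sum>k=1..m. std_normal_density (\<delta> k) * (right_limit f (\<delta> k) - left_limit f (\<delta> k))))" (is ?E)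
proof -
  have mono: "strict_mono_on {1..m} \<delta>"
    using pac by (simp add: p_absolutely_continuous_def)
  note loc = set_integrable_std_normal_weight[OF g int]
  let ?I = "\<lambda>k. einterval (breakpoint m \<delta> k) (breakpoint m \<delta> (Suc k))"
  obtain c where c: "\<And>k x. k \<le> m \<Longrightarrow> x \<in> ?I k \<Longrightarrow> f x = c k + primitive g x"
    using p_absolutely_continuous_eq_primitive[OF pac deriv g loc] by blast
  have right: "(f \<longlongrightarrow> c k + primitive g (\<delta> k)) (at_right (\<delta> k))"
    and left: "(f \<longlongrightarrow> c (k - 1) + primitive g (\<delta> k)) (at_left (\<delta> k))" if k: "k \<in> {1..m}" for k
  proof -
    have lim: "(primitive g \<longlongrightarrow> primitive g (\<delta> k)) (at (\<delta> k))"
      using isCont_primitive[OF g loc] by (simp add: isCont_def)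
    have "\<forall>\<^sub>F x in at_right (\<delta> k). c k + primitive g x = f x"
      using eventually_at_right_breakpoint[OF mono k] by eventually_elim (use k c in auto)
    moreover have "((\<lambda>x. c k + primitive g x) \<longlongrightarrow> c k + primitive g (\<delta> k)) (at_right (\<delta> k))"
      using lim by (intro tendsto_intros) (auto simp: filterlim_at_split)
    ultimately show "(f \<longlongrightarrow> c k + primitive g (\<delta> k)) (at_right (\<delta> k))"
      by (rule Lim_transform_eventually[rotated])
    have "\<forall>\<^sub>F x in at_left (\<delta> k). c (k - 1) + primitive g x = f x"
      using eventually_at_left_breakpoint[OF mono k] by eventually_elim (use k c[of "k - 1"] in auto)
    moreover have "((\<lambda>x. c (k - 1) + primitive g x) \<longlongrightarrow> c (k - 1) + primitive g (\<delta> k)) (at_left (\<delta> k))"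
      using lim by (intro tendsto_intros) (auto simp: filterlim_at_split)
    ultimately show "(f \<longlongrightarrow> c (k - 1) + primitive g (\<delta> k)) (at_left (\<delta> k))"
      by (rule Lim_transform_eventually[rotated])
  qed
  have rl: "right_limit f (\<delta> k) = c k + primitive g (\<delta> k)"
    and ll: "left_limit f (\<delta> k) = c (k - 1) + primitive g (\<delta> k)" if "k \<in> {1..m}" for k
    using right[OF that] left[OF that] unfolding right_limit_def left_limit_def
    by (auto intro!: tendsto_Lim)
  show "?R k" "?L k" if "k \<in> {1..m}"
    using right[OF that] left[OF that] rl[OF that] ll[OF that] by simp_all
  define J where "J k = right_limit f (\<delta> k) - left_limit f (\<delta> k)" for k
  have J: "J k = c k - c (k - 1)" if "k \<in> {1..m}" for k
    using rl[OF that] ll[OF that] by (simp add: J_def)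
  have rep: "f x = primitive g x + c 0 + (\<Sum>k=1..m. J k * indicator {\<delta> k<..} x)"
    if x: "x \<notin> \<delta> ` {1..m}" for x
  proof -
    obtain j where j: "j \<le> m" "{k \<in> {1..m}. \<delta> k < x} = {1..j}" "x \<in> ?I j"
      by (rule breakpoint_interval_containing[OF mono x])
    have "(\<Sum>k=1..m. J k * indicator {\<delta> k<..} x) = (\<Sum>k\<in>{k \<in> {1..m}. \<delta> k < x}. J k)"
      by (simp add: indicator_def if_distrib Int_def conj_assoc cong: if_cong)
    also have "\<dots> = (\<Sum>k=1..j. c k - c (k - 1))"
      unfolding j(2) using J j(1) by (intro sum.cong) auto
    also have "\<dots> = c j - c 0"
      by (induction j) auto
    finally show ?thesis using c[OF j(1,3)] by simp
  qed
  have const: "has_bochner_integral lborel (\<lambda>x. std_normal_density x * x * c 0) (0 * c 0)"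
    using integral_std_normal_moment_odd[of 0] integrable_std_normal_first_moment
    by (intro has_bochner_integral_mult_left) (simp add: has_bochner_integral_iff)
  have steps: "has_bochner_integral lborel
      (\<lambda>x. \<Sum>k=1..m. std_normal_density x * x * indicator {\<delta> k<..} x * J k)
      (\<Sum>k=1..m. std_normal_density (\<delta> k) * J k)"
    by (intro has_bochner_integral_sum has_bochner_integral_mult_left std_normal_first_moment_tail)
  have total: "has_bochner_integral lborel
      (\<lambda>x. std_normal_density x * (x * primitive g x) + std_normal_density x * x * c 0 +
        (\<Sum>k=1..m. std_normal_density x * x * indicator {\<delta> k<..} x * J k))
      ((\<integral>t. std_normal_density t * g t \<partial>lborel) + 0 * c 0 + (\<Sum>k=1..m. std_normal_density (\<delta> k) * J k))"
    by (intro has_bochner_integral_add stein_primitive const steps g int)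
  have [measurable]: "f \<in> borel_measurable borel"
    by (rule p_absolutely_continuous_borel_measurable[OF pac])
  have "AE x in lborel. x \<notin> \<delta> ` {1..m}"
    by (intro AE_not_in finite_imp_null_set_lborel) simp
  then have eq: "AE x in lborel. std_normal_density x * (x * primitive g x) + std_normal_density x * x * c 0 +
        (\<Sum>k=1..m. std_normal_density x * x * indicator {\<delta> k<..} x * J k) = std_normal_density x * (x * f x)"
  proof eventually_elim
    case (elim x)
    show ?case
      unfolding rep[OF elim] by (simp add: distrib_left sum_distrib_left mult_ac del: sum_mult_indicator)
  qed
  have "has_bochner_integral lborel (\<lambda>x. std_normal_density x * (x * f x))
      ((\<integral>t. std_normal_density t * g t \<partial>lborel) + 0 * c 0 + (\<Sum>k=1..m. std_normal_density (\<delta> k) * J k))"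
    using total by (subst has_bochner_integral_cong_AE[OF _ _ eq, symmetric])
      (auto dest: borel_measurable_has_bochner_integral)
  then show ?E by (simp add: J_def)
qed

theorem lemma4:
  fixes M :: "'w measure" and Z :: "'w \<Rightarrow> real"
    and f f' :: "real \<Rightarrow> real" and m :: nat and \<delta> :: "nat \<Rightarrow> real"
  assumes "prob_space M"
    and "distributed M lborel Z std_normal_density"
    and "p_absolutely_continuous m \<delta> f"
    and "ae_derivative f f'"
    and "integrable M (\<lambda>\<omega>. f' (Z \<omega>))"
  shows "(\<forall>k\<in>{1..m}. (f \<longlongrightarrow> right_limit f (\<delta> k)) (at_right (\<delta> k)) \<and>
                     (f \<longlongrightarrow> left_limit f (\<delta> k)) (at_left (\<delta> k))) \<and>
         integrable M (\<lambda>\<omega>. Z \<omega> * f (Z \<omega>)) \<and>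
         prob_space.expectation M (\<lambda>\<omega>. Z \<omega> * f (Z \<omega>)) =
           prob_space.expectation M (\<lambda>\<omega>. f' (Z \<omega>)) +
           (\<Sum>k=1..m. std_normal_density (\<delta> k) *
              (right_limit f (\<delta> k) - left_limit f (\<delta> k)))"
proof -
  interpret prob_space M by fact
  note D = assms(2) and pac = assms(3)
  have Z [measurable]: "Z \<in> borel_measurable M"
    using distributed_measurable[OF D] by simp
  have f [measurable]: "f \<in> borel_measurable borel"
    by (rule p_absolutely_continuous_borel_measurable[OF pac])
  define g where "g = forward_derivative f"
  have g [measurable]: "g \<in> borel_measurable borel"
    unfolding g_def by measurable
  obtain N where N: "N \<in> null_sets lborel"
    and derivN: "\<And>x. x \<notin> N \<Longrightarrow> (f has_real_derivative f' x) (at x)"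
  proof (rule AE_E3[OF assms(4)[unfolded ae_derivative_def]])
    fix N assume "N \<in> null_sets lborel"
      "\<And>x. x \<in> space lborel - N \<Longrightarrow> (f has_real_derivative f' x) (at x)"
    then show thesis by (intro that) auto
  qed
  have f'_eq: "f' x = g x" if "x \<notin> N" for x
    using forward_derivative_eq[OF derivN[OF that]] by (simp add: g_def)
  have deriv: "AE x in lborel. (f has_real_derivative g x) (at x)"
    using AE_not_in[OF N] by eventually_elim (metis derivN f'_eq)
  have [measurable]: "N \<in> sets borel" using null_setsD2[OF N] by simp
  \<comment> \<open>The law of \<open>Z\<close> has a density, so \<open>Z\<close> almost surely avoids the exceptional null set and \<open>f'\<close> may be replaced by its Borel version.\<close>
  have "AE \<omega> in M. Z \<omega> \<notin> N"
    using AE_not_in[OF N] by (subst distributed_AE2[OF D]) auto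
  then have f'_g: "AE \<omega> in M. f' (Z \<omega>) = g (Z \<omega>)"
    by eventually_elim (rule f'_eq)
  have f'Z: "(\<lambda>\<omega>. f' (Z \<omega>)) \<in> borel_measurable M"
    using assms(5) by (rule borel_measurable_integrable)
  have "integrable M (\<lambda>\<omega>. g (Z \<omega>))"
    using assms(5) integrable_cong_AE[OF f'Z _ f'_g] by simp
  then have int: "integrable lborel (\<lambda>t. std_normal_density t * g t)"
    using distributed_integrable[OF D, of g] by simp
  note stein = stein_std_normal_density[OF pac deriv g int]
  have "integrable M (\<lambda>\<omega>. Z \<omega> * f (Z \<omega>))"
    using stein(3) distributed_integrable[OF D, of "\<lambda>x. x * f x"] by (simp add: has_bochner_integral_iff)
  moreover have "expectation (\<lambda>\<omega>. Z \<omega> * f (Z \<omega>)) = (\<integral>x. std_normal_density x * (x * f x) \<partial>lborel)"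
    using distributed_integral[OF D, of "\<lambda>x. x * f x"] by simp
  moreover have "expectation (\<lambda>\<omega>. f' (Z \<omega>)) = (\<integral>t. std_normal_density t * g t \<partial>lborel)"
    using integral_cong_AE[OF f'Z _ f'_g] distributed_integral[OF D, of g] by simp
  ultimately show ?thesis
    using stein by (simp add: has_bochner_integral_iff)
qed

end
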